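(* Let $\mathbf K$ be the atomic amalgam of a pasted family $\{\mathbf K_i\}_{i\in I}$ of Kleene lattices. Then $\mathbf K$ is a paraorthomodular lattice if and only if it does not contain an atomic loop of order $3$ or $4$.
   Context: An antitone involution on a poset is a unary operation ${}'$ with $x''=x$ such that $x\leq y$ implies $y'\leq x'$. A bounded poset $(P,\leq,{}',0,1)$ with antitone involution is paraorthomodular if $x\leq y$ and $x'\wedge y=0$ together imply $x=y$. A paraorthomodular lattice is a lattice-ordered paraorthomodular poset. A Kleene lattice is a distributive paraorthomodular lattice satisfying $x\wedge x'\leq y\vee y'$ for all $x,y$. A pasted family of Kleene lattices is a family $\{\mathbf K_i\}_{i\in I}$ of finite Kleene lattices (all with the same $0$ and $1$) such that $|K_i|\geq 6$ for all $i$ and, for $i\neq j$: $K_i\cap K_j$ is either $\{0,1\}$ or an (atomic) Kleene subalgebra of both $\mathbf K_i$ and $\mathbf K_j$ on which the operations $\wedge,\vee,{}',0,1$ of $\mathbf K_i$ and $\mathbf K_j$ coincide; $|K_i\cap K_j|\leq 4$; and every $x\in (K_i\cap K_j)\smallsetminus\{0,1\}$ is either an atom in both $\mathbf K_i$ and $\mathbf K_j$ or a co-atom in both. Its atomic amalgam is $\mathbf K=(K,\leq,{}',0,1)$, where $K=\bigcup_{i\in I}K_i$; $x\leq y$ iff there is $i\in I$ with $x,y\in K_i$ and $x\leq^{\mathbf K_i}y$; and $x'$ is the involute of $x$ computed in any $\mathbf K_i$ with $x\in K_i$. This is a well-defined bounded poset with antitone involution. For $n\geq 3$, members $\mathbf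 K_{i_1},\dots,\mathbf K_{i_n}$ of the family form an atomic loop of order $n$ for $\mathbf K$ if: (1) $|K_{i_j}\cap K_{i_{j+1}}|=4$ for $1\leq j<n$, and $|K_{i_n}\cap K_{i_1}|=4$; (2) for any other pair of distinct indices $1\leq j,k\leq n$ (not mentioned in (1)), $K_{i_j}\cap K_{i_k}=\{0,1\}$; (3) for all $1\leq j<k<l\leq n$, $K_{i_j}\cap K_{i_k}\cap K_{i_l}=\{0,1\}$. *)

theory Defs
  imports "HOL-Algebra.Lattice"
begin

record 'a inv_poset = "'a gorder" +
  zero :: 'a (\<open>\<zero>\<index>\<close>)
  one :: 'a (\<open>\<one>\<index>\<close>)
  invol :: "'a \<Rightarrow> 'a" (\<open>\<sim>\<index> _\<close> [81] 80)

locale bounded_involution_poset = partial_order L for L (structure) +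
  assumes zero_least: "least L \<zero> (carrier L)"
    and one_greatest: "greatest L \<one> (carrier L)"
    and invol_closed: "x \<in> carrier L \<Longrightarrow> \<sim> x \<in> carrier L"
    and invol_invol: "x \<in> carrier L \<Longrightarrow> \<sim> (\<sim> x) = x"
    and invol_antitone: "x \<in> carrier L \<Longrightarrow> y \<in> carrier L \<Longrightarrow> x \<sqsubseteq> y \<Longrightarrow> \<sim> y \<sqsubseteq> \<sim> x"

text \<open>In a poset the equation \<open>x' \<and> y = 0\<close> means that the infimum of \<open>x'\<close> and \<open>y\<close> exists and
  is \<open>0\<close>. It is therefore not written with the operation \<open>\<sqinter>\<close>, whose value is unspecified when
  the infimum does not exist.\<close>

locale paraorthomodular_poset = bounded_involution_poset +
  assumes paraorthomodular: "x \<in> carrier L \<Longrightarrow> y \<in> carrier L \<Longrightarrow> x \<sqsubseteq> y \<Longrightarrow>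
    greatest L \<zero> (Lower L {\<sim> x, y}) \<Longrightarrow> x = y"

locale paraorthomodular_lattice = paraorthomodular_poset + lattice

locale kleene_lattice = paraorthomodular_lattice +
  assumes distributive: "x \<in> carrier L \<Longrightarrow> y \<in> carrier L \<Longrightarrow> z \<in> carrier L \<Longrightarrow>
      x \<sqinter> (y \<squnion> z) = (x \<sqinter> y) \<squnion> (x \<sqinter> z)"
    and kleene: "x \<in> carrier L \<Longrightarrow> y \<in> carrier L \<Longrightarrow> x \<sqinter> \<sim> x \<sqsubseteq> y \<squnion> \<sim> y"

definition atom :: "('a, 'b) inv_poset_scheme \<Rightarrow> 'a \<Rightarrow> bool" where
  "atom L a \<longleftrightarrow> a \<in> carrier L \<and> a \<noteq> \<zero>\<^bsub>L\<^esub> \<and>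
     (\<forall>x\<in>carrier L. x \<sqsubseteq>\<^bsub>L\<^esub> a \<longrightarrow> x = \<zero>\<^bsub>L\<^esub> \<or> x = a)"

definition coatom :: "('a, 'b) inv_poset_scheme \<Rightarrow> 'a \<Rightarrow> bool" where
  "coatom L a \<longleftrightarrow> a \<in> carrier L \<and> a \<noteq> \<one>\<^bsub>L\<^esub> \<and>
     (\<forall>x\<in>carrier L. a \<sqsubseteq>\<^bsub>L\<^esub> x \<longrightarrow> x = \<one>\<^bsub>L\<^esub> \<or> x = a)"

definition atomic :: "('a, 'b) inv_poset_scheme \<Rightarrow> bool" where
  "atomic L \<longleftrightarrow> (\<forall>x\<in>carrier L. x \<noteq> \<zero>\<^bsub>L\<^esub> \<longrightarrow> (\<exists>a. atom L a \<and> a \<sqsubseteq>\<^bsub>L\<^esub> x))"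

definition atomic_kleene_subalgebra :: "'a set \<Rightarrow> ('a, 'b) inv_poset_scheme \<Rightarrow> bool" where
  "atomic_kleene_subalgebra S L \<longleftrightarrow>
     S \<subseteq> carrier L \<and> \<zero>\<^bsub>L\<^esub> \<in> S \<and> \<one>\<^bsub>L\<^esub> \<in> S \<and>
     (\<forall>x\<in>S. \<sim>\<^bsub>L\<^esub> x \<in> S) \<and>
     (\<forall>x\<in>S. \<forall>y\<in>S. x \<sqinter>\<^bsub>L\<^esub> y \<in> S \<and> x \<squnion>\<^bsub>L\<^esub> y \<in> S) \<and>
     kleene_lattice (L\<lparr>carrier := S\<rparr>) \<and> atomic (L\<lparr>carrier := S\<rparr>)"

definition operations_coincide ::
  "'a set \<Rightarrow> ('a, 'b) inv_poset_scheme \<Rightarrow> ('a, 'c) inv_poset_scheme \<Rightarrow> bool" where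
  "operations_coincide S L M \<longleftrightarrow>
     \<zero>\<^bsub>L\<^esub> = \<zero>\<^bsub>M\<^esub> \<and> \<one>\<^bsub>L\<^esub> = \<one>\<^bsub>M\<^esub> \<and>
     (\<forall>x\<in>S. \<sim>\<^bsub>L\<^esub> x = \<sim>\<^bsub>M\<^esub> x) \<and>
     (\<forall>x\<in>S. \<forall>y\<in>S. x \<sqinter>\<^bsub>L\<^esub> y = x \<sqinter>\<^bsub>M\<^esub> y \<and> x \<squnion>\<^bsub>L\<^esub> y = x \<squnion>\<^bsub>M\<^esub> y)"

text \<open>The index set is required to be nonempty: otherwise the amalgam would have an empty universe
  and could not be bounded.\<close>

locale pasted_family =
  fixes I :: "'i set" and K :: "'i \<Rightarrow> ('a, 'b) inv_poset_scheme"
  assumes index_nonempty: "I \<noteq> {}"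
    and kleene_member: "i \<in> I \<Longrightarrow> kleene_lattice (K i)"
    and finite_member: "i \<in> I \<Longrightarrow> finite (carrier (K i))"
    and card_member: "i \<in> I \<Longrightarrow> card (carrier (K i)) \<ge> 6"
    and same_bounds: "i \<in> I \<Longrightarrow> j \<in> I \<Longrightarrow> \<zero>\<^bsub>K i\<^esub> = \<zero>\<^bsub>K j\<^esub> \<and> \<one>\<^bsub>K i\<^esub> = \<one>\<^bsub>K j\<^esub>"
    and intersection: "i \<in> I \<Longrightarrow> j \<in> I \<Longrightarrow> i \<noteq> j \<Longrightarrow>
      carrier (K i) \<inter> carrier (K j) = {\<zero>\<^bsub>K i\<^esub>, \<one>\<^bsub>K i\<^esub>} \<or>
      atomic_kleene_subalgebra (carrier (K i) \<inter> carrier (K j)) (K i) \<and>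
      atomic_kleene_subalgebra (carrier (K i) \<inter> carrier (K j)) (K j) \<and>
      operations_coincide (carrier (K i) \<inter> carrier (K j)) (K i) (K j)"
    and card_intersection: "i \<in> I \<Longrightarrow> j \<in> I \<Longrightarrow> i \<noteq> j \<Longrightarrow>
      card (carrier (K i) \<inter> carrier (K j)) \<le> 4"
    and atom_or_coatom: "i \<in> I \<Longrightarrow> j \<in> I \<Longrightarrow> i \<noteq> j \<Longrightarrow>
      x \<in> carrier (K i) \<inter> carrier (K j) - {\<zero>\<^bsub>K i\<^esub>, \<one>\<^bsub>K i\<^esub>} \<Longrightarrow>
      atom (K i) x \<and> atom (K j) x \<or> coatom (K i) x \<and> coatom (K j) x"

text \<open>The bounds are common to all members, and the involution of \<open>x\<close> is the same in all members
  containing \<open>x\<close>, so the index picked by \<open>SOME\<close> is irrelevant.\<close>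

definition atomic_amalgam :: "'i set \<Rightarrow> ('i \<Rightarrow> ('a, 'b) inv_poset_scheme) \<Rightarrow> 'a inv_poset" where
  "atomic_amalgam I K =
     \<lparr> carrier = (\<Union>i\<in>I. carrier (K i)),
       eq = (=),
       le = (\<lambda>x y. \<exists>i\<in>I. x \<in> carrier (K i) \<and> y \<in> carrier (K i) \<and> x \<sqsubseteq>\<^bsub>K i\<^esub> y),
       zero = \<zero>\<^bsub>K (SOME i. i \<in> I)\<^esub>,
       one = \<one>\<^bsub>K (SOME i. i \<in> I)\<^esub>,
       invol = (\<lambda>x. \<sim>\<^bsub>K (SOME i. i \<in> I \<and> x \<in> carrier (K i))\<^esub> x) \<rparr>"

text \<open>The loop is the sequence of members \<open>K (s 1), \<dots>, K (s n)\<close>; the values of \<open>s\<close> outside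
  \<open>{1..n}\<close> are irrelevant.\<close>

definition atomic_loop ::
  "'i set \<Rightarrow> ('i \<Rightarrow> ('a, 'b) inv_poset_scheme) \<Rightarrow> nat \<Rightarrow> (nat \<Rightarrow> 'i) \<Rightarrow> bool" where
  "atomic_loop I K n s \<longleftrightarrow>
     n \<ge> 3 \<and> (\<forall>j\<in>{1..n}. s j \<in> I) \<and>
     (\<forall>j. 1 \<le> j \<and> j < n \<longrightarrow> card (carrier (K (s j)) \<inter> carrier (K (s (j + 1)))) = 4) \<and>
     card (carrier (K (s n)) \<inter> carrier (K (s 1))) = 4 \<and>
     (\<forall>j\<in>{1..n}. \<forall>k\<in>{1..n}.
        j \<noteq> k \<and> k \<noteq> j + 1 \<and> j \<noteq> k + 1 \<and> {j, k} \<noteq> {1, n} \<longrightarrow>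
        carrier (K (s j)) \<inter> carrier (K (s k)) =
          {\<zero>\<^bsub>atomic_amalgam I K\<^esub>, \<one>\<^bsub>atomic_amalgam I K\<^esub>}) \<and>
     (\<forall>j k l. 1 \<le> j \<and> j < k \<and> k < l \<and> l \<le> n \<longrightarrow>
        carrier (K (s j)) \<inter> carrier (K (s k)) \<inter> carrier (K (s l)) =
          {\<zero>\<^bsub>atomic_amalgam I K\<^esub>, \<one>\<^bsub>atomic_amalgam I K\<^esub>})"

end

theory Submission
  imports Defs
begin

text \<open>In a Kleene lattice with at least six elements no atom is a coatom, distinct atoms \<open>a\<close>, \<open>b\<close>
  satisfy \<open>a \<le> b'\<close>, and the join of two atoms is below 1. Hence two members that meet outside
  \<open>{0, 1}\<close> meet in exactly \<open>{0, 1, a, a'}\<close> for an atom \<open>a\<close>, every element of the amalgam that is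
  neither extreme nor an atom or coatom lies in just one member, and two distinct atoms determine
  the member containing them. The amalgam is always paraorthomodular, because \<open>x \<le> y\<close> takes place
  in one member, so only the existence of binary suprema is at stake.

  In a loop of order 3 with atoms \<open>a\<close>, \<open>b\<close>, \<open>c\<close>, both \<open>c'\<close> and the join of \<open>a\<close>, \<open>b\<close> in their
  common member are upper bounds of \<open>a\<close>, \<open>b\<close>; in a loop of order 4 with atoms \<open>a\<close>, \<open>b\<close>, \<open>c\<close>,
  \<open>d\<close>, both \<open>b'\<close> and \<open>d'\<close> are upper bounds of \<open>a\<close>, \<open>c\<close>. A supremum would lie strictly between
  an atom and a coatom, hence in a single member containing too many of the atoms. Conversely,
  an upper bound of two elements of one member that lies outside that member closes a loop of
  order 3, and upper bounds other than 1 of elements without a common member are coatoms, two of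
  which close a loop of order 3 or 4.\<close>

section \<open>Involution posets and Kleene lattices\<close>

lemma (in weak_partial_order) least_Upper_pair_iff:
  assumes "x \<in> carrier L" "y \<in> carrier L"
  shows "least L s (Upper L {x, y}) \<longleftrightarrow>
    s \<in> carrier L \<and> x \<sqsubseteq> s \<and> y \<sqsubseteq> s \<and> (\<forall>u\<in>carrier L. x \<sqsubseteq> u \<longrightarrow> y \<sqsubseteq> u \<longrightarrow> s \<sqsubseteq> u)"
  using assms by (auto simp: least_def Upper_def)

lemma (in weak_partial_order) greatest_Lower_pair_iff:
  assumes "x \<in> carrier L" "y \<in> carrier L"
  shows "greatest L s (Lower L {x, y}) \<longleftrightarrow>
    s \<in> carrier L \<and> s \<sqsubseteq> x \<and> s \<sqsubseteq> y \<and> (\<forall>u\<in>carrier L. u \<sqsubseteq> x \<longrightarrow> u \<sqsubseteq> y \<longrightarrow> u \<sqsubseteq> s)"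
  using assms by (auto simp: greatest_def Lower_def)

section \<open>Duality under an antitone involution\<close>

context bounded_involution_poset
begin

lemma zero_closed [simp]: "\<zero> \<in> carrier L"
  using zero_least by (simp add: least_def)

lemma one_closed [simp]: "\<one> \<in> carrier L"
  using one_greatest by (simp add: greatest_def)

lemma zero_le [simp]: "x \<in> carrier L \<Longrightarrow> \<zero> \<sqsubseteq> x"
  using zero_least by (simp add: least_def)

lemma le_one [simp]: "x \<in> carrier L \<Longrightarrow> x \<sqsubseteq> \<one>"
  using one_greatest by (simp add: greatest_def)

lemma le_zero_iff: "x \<in> carrier L \<Longrightarrow> x \<sqsubseteq> \<zero> \<longleftrightarrow> x = \<zero>"
  using le_antisym by fastforce

lemma one_le_iff: "x \<in> carrier L \<Longrightarrow> \<one> \<sqsubseteq> x \<longleftrightarrow> x = \<one>"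
  using le_antisym by fastforce

declare invol_closed [simp] invol_invol [simp]

lemma invol_le_iff: "x \<in> carrier L \<Longrightarrow> y \<in> carrier L \<Longrightarrow> \<sim> x \<sqsubseteq> y \<longleftrightarrow> \<sim> y \<sqsubseteq> x"
  by (metis invol_antitone invol_closed invol_invol)

lemma le_invol_iff: "x \<in> carrier L \<Longrightarrow> y \<in> carrier L \<Longrightarrow> x \<sqsubseteq> \<sim> y \<longleftrightarrow> y \<sqsubseteq> \<sim> x"
  by (metis invol_antitone invol_closed invol_invol)

lemma invol_zero [simp]: "\<sim> \<zero> = \<one>"
  using le_invol_iff [of \<one> \<zero>] by (simp add: one_le_iff)

lemma invol_one [simp]: "\<sim> \<one> = \<zero>"
  by (metis invol_invol invol_zero zero_closed)

lemma atom_imp_coatom_invol: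
  assumes "atom L x"
  shows "coatom L (\<sim> x)"
  unfolding coatom_def
proof (intro conjI ballI impI)
  have x: "x \<in> carrier L" "x \<noteq> \<zero>" using assms by (auto simp: atom_def)
  then show "\<sim> x \<in> carrier L" by simp
  show "\<sim> x \<noteq> \<one>" using x invol_invol invol_one by metis
  fix y assume y: "y \<in> carrier L" "\<sim> x \<sqsubseteq> y"
  then have "\<sim> y \<sqsubseteq> x" using x by (simp add: invol_le_iff)
  then have "\<sim> y = \<zero> \<or> \<sim> y = x" using assms y by (simp add: atom_def)
  then show "y = \<one> \<or> y = \<sim> x" using y invol_invol invol_zero by metis
qed

lemma coatom_imp_atom_invol:
  assumes "coatom L x"
  shows "atom L (\<sim> x)"
  unfolding atom_def
proof (intro conjI ballI impI)
  have x: "x \<in> carrier L" "x \<noteq> \<one>" using assms by (auto simp: coatom_def)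
  then show "\<sim> x \<in> carrier L" by simp
  show "\<sim> x \<noteq> \<zero>" using x invol_invol invol_zero by metis
  fix y assume y: "y \<in> carrier L" "y \<sqsubseteq> \<sim> x"
  then have "x \<sqsubseteq> \<sim> y" using x by (simp add: le_invol_iff)
  then have "\<sim> y = \<one> \<or> \<sim> y = x" using assms y by (simp add: coatom_def)
  then show "y = \<zero> \<or> y = \<sim> x" using y invol_invol invol_one by metis
qed

lemma coatom_invol_iff: "x \<in> carrier L \<Longrightarrow> coatom L (\<sim> x) \<longleftrightarrow> atom L x"
  using atom_imp_coatom_invol coatom_imp_atom_invol [of "\<sim> x"] by auto

lemma atom_invol_iff: "x \<in> carrier L \<Longrightarrow> atom L (\<sim> x) \<longleftrightarrow> coatom L x"
  using coatom_imp_atom_invol atom_imp_coatom_invol [of "\<sim> x"] by auto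

text \<open>The infimum of x and y is the involute of the supremum of their involutes, so binary
  suprema suffice.\<close>

lemma lattice_if_sups:
  assumes sups: "\<And>x y. x \<in> carrier L \<Longrightarrow> y \<in> carrier L \<Longrightarrow> \<exists>s. least L s (Upper L {x, y})"
  shows "lattice L"
proof
  fix x y
  assume xy: "x \<in> carrier L" "y \<in> carrier L"
  show "\<exists>s. least L s (Upper L {x, y})"
    using sups xy .
  obtain s where s: "least L s (Upper L {\<sim> x, \<sim> y})"
    using sups xy invol_closed by blast
  with xy have "greatest L (\<sim> s) (Lower L {x, y})"
    by (simp add: least_Upper_pair_iff greatest_Lower_pair_iff)
      (metis invol_closed invol_antitone invol_invol)
  then show "\<exists>s. greatest L s (Lower L {x, y})" ..
qed

end

section \<open>Disjointness, atoms and coatoms in a Kleene lattice\<close>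

context kleene_lattice
begin

text \<open>De Morgan turns a \<sqinter> b = 0 into a' \<squnion> b' = 1, so by distributivity a is
  the join of \<open>c\<close> = a \<sqinter> a' and a \<sqinter> b'. The latter is below b'. The
  element \<open>c\<close> need not be 0, but the Kleene inequality puts it below b \<squnion> b',
  and since its meet with b is 0, it is below b' as well.\<close>

lemma disjoint_imp_le_invol:
  assumes a: "a \<in> carrier L" and b: "b \<in> carrier L" and ab: "a \<sqinter> b = \<zero>"
  shows "a \<sqsubseteq> \<sim> b"
proof -
  have "\<sim> (\<sim> a \<squnion> \<sim> b) \<sqsubseteq> a \<sqinter> b"
    using a b by (intro meet_le) (auto simp: invol_le_iff join_left join_right)
  then have one: "\<sim> a \<squnion> \<sim> b = \<one>"
    using a b ab by (metis invol_closed invol_invol invol_zero join_closed le_zero_iff)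
  define c where "c = a \<sqinter> \<sim> a"
  have c: "c \<in> carrier L" using a by (simp add: c_def)
  have "c \<sqsubseteq> b \<squnion> \<sim> b" using a b kleene by (simp add: c_def)
  then have "c = c \<sqinter> (b \<squnion> \<sim> b)" using b c by (simp add: le_iff_join)
  also have "\<dots> = (c \<sqinter> b) \<squnion> (c \<sqinter> \<sim> b)" using b c by (simp add: distributive)
  also have "\<dots> \<sqsubseteq> \<sim> b"
  proof (rule join_le)
    have "c \<sqinter> b \<sqsubseteq> a \<sqinter> b"
      using a b c by (metis c_def invol_closed le_trans meet_closed meet_le meet_left meet_right)
    then show "c \<sqinter> b \<sqsubseteq> \<sim> b"
      using ab b c by (metis invol_closed le_zero_iff meet_closed zero_le)
  qed (use b c in \<open>auto simp: meet_right\<close>)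
  finally have "c \<sqsubseteq> \<sim> b" .
  have "a = a \<sqinter> (\<sim> a \<squnion> \<sim> b)" using a by (simp add: one flip: le_iff_join)
  also have "\<dots> = c \<squnion> (a \<sqinter> \<sim> b)" using a b by (simp add: distributive c_def)
  also have "\<dots> \<sqsubseteq> \<sim> b"
    using \<open>c \<sqsubseteq> \<sim> b\<close> a b c by (auto intro: join_le simp: meet_right)
  finally show ?thesis .
qed

lemma atom_meet:
  assumes "atom L a" "x \<in> carrier L" "\<not> a \<sqsubseteq> x"
  shows "a \<sqinter> x = \<zero>"
  using assms unfolding atom_def by (metis meet_closed meet_left meet_right)

lemma distinct_atoms_le_invol:
  assumes "atom L a" "atom L b" "a \<noteq> b"
  shows "a \<sqsubseteq> \<sim> b"
  using assms atom_meet disjoint_imp_le_invol unfolding atom_def by metis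

text \<open>If a were both, every element other than 0, a and 1 would be a complement of a.
  Complements in a distributive lattice are unique, which leaves at most four elements.\<close>

lemma atom_not_coatom:
  assumes big: "card (carrier L) > 4" and a: "atom L a"
  shows "\<not> coatom L a"
proof
  assume ca: "coatom L a"
  have ac: "a \<in> carrier L" using a by (simp add: atom_def)
  let ?R = "carrier L - {\<zero>, a, \<one>}"
  have compl: "a \<sqinter> x = \<zero> \<and> a \<squnion> x = \<one>" if "x \<in> ?R" for x
  proof
    have x: "x \<in> carrier L" using that by simp
    show "a \<sqinter> x = \<zero>"
      using atom_meet [OF a x] that ca unfolding coatom_def by auto
    have "a \<squnion> x \<noteq> a"
      using ac x that a join_right [OF ac x] unfolding atom_def by auto
    then show "a \<squnion> x = \<one>"
      using ac x ca join_left [OF ac x] unfolding coatom_def by auto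
  qed
  \<comment> \<open>Uniqueness of complements: x and y play symmetric roles, so antisymmetry
    identifies any two elements of \<open>?R\<close>.\<close>
  have le: "x \<sqsubseteq> y" if "x \<in> ?R" "y \<in> ?R" for x y
  proof -
    have xy: "x \<in> carrier L" "y \<in> carrier L" using that by auto
    have "x = x \<sqinter> (a \<squnion> y)" using compl that xy by (simp flip: le_iff_join)
    also have "\<dots> = (x \<sqinter> a) \<squnion> (x \<sqinter> y)" using ac xy by (simp add: distributive)
    also have "\<dots> = \<zero> \<squnion> (x \<sqinter> y)" using compl that by (simp add: meet_comm [of L x a])
    also have "\<dots> \<sqsubseteq> y" using xy by (auto intro: join_le simp: meet_right)
    finally show ?thesis .
  qed
  have "card (carrier L) \<le> 4"
  proof (cases "?R = {}")
    case True
    then have "carrier L \<subseteq> {\<zero>, a, \<one>}" by auto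
    then have "card (carrier L) \<le> card {\<zero>, a, \<one>}" by (intro card_mono) auto
    also have "\<dots> \<le> 4" by (simp add: card_insert_if)
    finally show ?thesis .
  next
    case False
    then obtain x where "x \<in> ?R" by blast
    then have "carrier L \<subseteq> {\<zero>, a, \<one>, x}" using le le_antisym by blast
    then have "card (carrier L) \<le> card {\<zero>, a, \<one>, x}" by (intro card_mono) auto
    also have "\<dots> \<le> 4" by (simp add: card_insert_if)
    finally show ?thesis .
  qed
  then show False using big by simp
qed

lemma atom_ne_one:
  assumes big: "card (carrier L) > 4" and a: "atom L a"
  shows "a \<noteq> \<one>"
proof
  assume "a = \<one>"
  then have "carrier L \<subseteq> {\<zero>, \<one>}" using a unfolding atom_def by auto
  then have "card (carrier L) \<le> card {\<zero>, \<one>}" by (intro card_mono) auto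
  also have "\<dots> \<le> 4" by (simp add: card_insert_if)
  finally show False using big by simp
qed

text \<open>If the join were 1, then a would be a coatom: an x above a either lies above b too, so x
  = 1, or is disjoint from b, and then distributing x over the join gives x \<sqsubseteq> a. But no
  atom is a coatom.\<close>

lemma join_atoms_ne_one:
  assumes big: "card (carrier L) > 4" and a: "atom L a" and b: "atom L b"
  shows "a \<squnion> b \<noteq> \<one>"
proof
  assume one: "a \<squnion> b = \<one>"
  have ac: "a \<in> carrier L" and bc: "b \<in> carrier L" using a b by (auto simp: atom_def)
  have "x = \<one> \<or> x = a" if x: "x \<in> carrier L" and ax: "a \<sqsubseteq> x" for x
  proof (cases "b \<sqsubseteq> x")
    case True
    then have "\<one> \<sqsubseteq> x" using one join_le ax ac bc x by metis
    then show ?thesis using x by (simp add: one_le_iff)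
  next
    case False
    then have "x \<sqinter> b = \<zero>" using atom_meet [OF b x] by (simp add: meet_comm)
    moreover have "x = x \<sqinter> (a \<squnion> b)" using one x by (simp flip: le_iff_join)
    ultimately have "x = (x \<sqinter> a) \<squnion> \<zero>" using ac bc x by (simp add: distributive)
    moreover have "(x \<sqinter> a) \<squnion> \<zero> \<sqsubseteq> a" using ac x by (auto intro: join_le simp: meet_right)
    ultimately show ?thesis using ax ac x le_antisym by metis
  qed
  then have "coatom L a" using atom_ne_one [OF big a] ac by (simp add: coatom_def)
  then show False using atom_not_coatom big a by blast
qed

end

section \<open>The atomic amalgam as an involution poset\<close>

context pasted_family
begin

abbreviation C :: "'i \<Rightarrow> 'a set" where "C i \<equiv> carrier (K i)"

abbreviation M :: "'a inv_poset" where "M \<equiv> atomic_amalgam I K"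

lemma member_big: "i \<in> I \<Longrightarrow> card (C i) > 4"
  using card_member by fastforce

lemma carrier_amalgam: "carrier M = (\<Union>i\<in>I. C i)"
  by (simp add: atomic_amalgam_def)

lemma zero_amalgam: "i \<in> I \<Longrightarrow> \<zero>\<^bsub>M\<^esub> = \<zero>\<^bsub>K i\<^esub>"
  using same_bounds [of "SOME i. i \<in> I" i] index_nonempty by (simp add: atomic_amalgam_def some_in_eq)

lemma one_amalgam: "i \<in> I \<Longrightarrow> \<one>\<^bsub>M\<^esub> = \<one>\<^bsub>K i\<^esub>"
  using same_bounds [of "SOME i. i \<in> I" i] index_nonempty by (simp add: atomic_amalgam_def some_in_eq)

lemma zero_in_member [simp]: "i \<in> I \<Longrightarrow> \<zero>\<^bsub>M\<^esub> \<in> C i"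
  and one_in_member [simp]: "i \<in> I \<Longrightarrow> \<one>\<^bsub>M\<^esub> \<in> C i"
proof -
  assume i: "i \<in> I"
  interpret Ki: kleene_lattice "K i" using i by (rule kleene_member)
  show "\<zero>\<^bsub>M\<^esub> \<in> C i" "\<one>\<^bsub>M\<^esub> \<in> C i" using i by (simp_all add: zero_amalgam one_amalgam)
qed

lemma zero_ne_one: "\<zero>\<^bsub>M\<^esub> \<noteq> \<one>\<^bsub>M\<^esub>"
proof
  assume eq: "\<zero>\<^bsub>M\<^esub> = \<one>\<^bsub>M\<^esub>"
  obtain i where i: "i \<in> I" using index_nonempty by blast
  interpret Ki: kleene_lattice "K i" using i by (rule kleene_member)
  have "\<one>\<^bsub>K i\<^esub> = \<zero>\<^bsub>K i\<^esub>" using eq by (simp add: zero_amalgam [OF i] one_amalgam [OF i])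
  then have "x = \<zero>\<^bsub>K i\<^esub>" if "x \<in> C i" for x
    using Ki.le_one [OF that] Ki.le_zero_iff [OF that] by simp
  then have "C i \<subseteq> {\<zero>\<^bsub>K i\<^esub>}" by blast
  then have "card (C i) \<le> card {\<zero>\<^bsub>K i\<^esub>}" by (intro card_mono) auto
  then show False using member_big [OF i] by simp
qed

text \<open>If the overlap is just {0, 1}, the common bounds determine involution and order on it.
  Otherwise the operations coincide by assumption, and the order is recovered from the meet.\<close>

lemma member_coincide:
  assumes i: "i \<in> I" and j: "j \<in> I" and x: "x \<in> C i \<inter> C j"
  shows invol_coincide: "\<sim>\<^bsub>K i\<^esub> x = \<sim>\<^bsub>K j\<^esub> x"
    and le_coincide: "y \<in> C i \<inter> C j \<Longrightarrow> x \<sqsubseteq>\<^bsub>K i\<^esub> y \<longleftrightarrow> x \<sqsubseteq>\<^bsub>K j\<^esub> y"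
proof -
  interpret Ki: kleene_lattice "K i" using i by (rule kleene_member)
  interpret Kj: kleene_lattice "K j" using j by (rule kleene_member)
  have b: "\<zero>\<^bsub>K j\<^esub> = \<zero>\<^bsub>K i\<^esub>" "\<one>\<^bsub>K j\<^esub> = \<one>\<^bsub>K i\<^esub>" using same_bounds [OF i j] by auto
  \<comment> \<open>Rewriting these with \<open>b\<close> makes them speak of the bounds of
    \<open>K i\<close>, in which the two-element case is phrased.\<close>
  note Kj_b = Kj.zero_le Kj.le_one Kj.one_le_iff Kj.zero_closed Kj.one_closed
  consider (same) "i = j" | (trivial) "C i \<inter> C j = {\<zero>\<^bsub>K i\<^esub>, \<one>\<^bsub>K i\<^esub>}"
    | (ops) "operations_coincide (C i \<inter> C j) (K i) (K j)"
    using intersection i j by blast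
  note cases = this
  show "\<sim>\<^bsub>K i\<^esub> x = \<sim>\<^bsub>K j\<^esub> x"
    using cases
  proof cases
    case trivial
    then show ?thesis using x Kj.invol_zero [unfolded b] Kj.invol_one [unfolded b] by auto
  qed (use x in \<open>auto simp: operations_coincide_def\<close>)
  assume y: "y \<in> C i \<inter> C j"
  show "x \<sqsubseteq>\<^bsub>K i\<^esub> y \<longleftrightarrow> x \<sqsubseteq>\<^bsub>K j\<^esub> y"
    using cases
  proof cases
    case trivial
    have "x \<in> {\<zero>\<^bsub>K i\<^esub>, \<one>\<^bsub>K i\<^esub>}" "y \<in> {\<zero>\<^bsub>K i\<^esub>, \<one>\<^bsub>K i\<^esub>}" using x y trivial by auto
    then show ?thesis by (auto simp: Ki.one_le_iff Kj_b [unfolded b])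
  next
    case ops
    then have "x \<sqinter>\<^bsub>K i\<^esub> y = x \<sqinter>\<^bsub>K j\<^esub> y" using x y by (simp add: operations_coincide_def)
    then show ?thesis using x y by (simp add: Ki.le_iff_join Kj.le_iff_join)
  qed auto
qed

text \<open>The comparison may be witnessed by another member, but then x and y lie in its overlap
  with \<open>K i\<close>, where both orders agree.\<close>

lemma le_amalgam:
  assumes "i \<in> I" "x \<in> C i" "y \<in> C i"
  shows "x \<sqsubseteq>\<^bsub>M\<^esub> y \<longleftrightarrow> x \<sqsubseteq>\<^bsub>K i\<^esub> y"
proof
  assume "x \<sqsubseteq>\<^bsub>M\<^esub> y"
  then obtain j where "j \<in> I" "x \<in> C j" "y \<in> C j" "x \<sqsubseteq>\<^bsub>K j\<^esub> y"
    by (auto simp: atomic_amalgam_def)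
  then show "x \<sqsubseteq>\<^bsub>K i\<^esub> y"
    using assms le_coincide [of j i x y] by blast
next
  assume "x \<sqsubseteq>\<^bsub>K i\<^esub> y"
  then show "x \<sqsubseteq>\<^bsub>M\<^esub> y"
    using assms by (auto simp: atomic_amalgam_def)
qed

lemma le_amalgamE:
  assumes "x \<sqsubseteq>\<^bsub>M\<^esub> y"
  obtains i where "i \<in> I" "x \<in> C i" "y \<in> C i"
  using assms by (auto simp: atomic_amalgam_def)

lemma invol_amalgam:
  assumes "i \<in> I" "x \<in> C i"
  shows "\<sim>\<^bsub>M\<^esub> x = \<sim>\<^bsub>K i\<^esub> x"
proof -
  define j where "j = (SOME i. i \<in> I \<and> x \<in> C i)"
  have "j \<in> I \<and> x \<in> C j"
    unfolding j_def by (rule someI [of _ i]) (use assms in blast)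
  then show ?thesis
    using assms invol_coincide [of i j x] by (simp add: atomic_amalgam_def flip: j_def)
qed

lemma invol_in_member:
  assumes i: "i \<in> I" and x: "x \<in> C i"
  shows "\<sim>\<^bsub>M\<^esub> x \<in> C i"
proof -
  interpret Ki: kleene_lattice "K i" using i by (rule kleene_member)
  show ?thesis using i x by (simp add: invol_amalgam)
qed

lemma overlap_cases:
  assumes "i \<in> I" "j \<in> I" "i \<noteq> j" "x \<in> C i \<inter> C j" "x \<noteq> \<zero>\<^bsub>M\<^esub>" "x \<noteq> \<one>\<^bsub>M\<^esub>"
  obtains "atom (K i) x" "atom (K j) x" | "coatom (K i) x" "coatom (K j) x"
  using assms atom_or_coatom [of i j x] by (auto simp: zero_amalgam one_amalgam)

text \<open>The two comparisons may take place in different members. Then y lies in their overlap.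
  If y is not a bound, it is an atom of both, so that x is 0 or y, or a coatom of both, so that z is
  1 or y.\<close>

lemma le_amalgam_trans:
  assumes xy: "x \<sqsubseteq>\<^bsub>M\<^esub> y" and yz: "y \<sqsubseteq>\<^bsub>M\<^esub> z"
  shows "x \<sqsubseteq>\<^bsub>M\<^esub> z"
proof -
  obtain i where i: "i \<in> I" "x \<in> C i" "y \<in> C i" using xy by (rule le_amalgamE)
  obtain j where j: "j \<in> I" "y \<in> C j" "z \<in> C j" using yz by (rule le_amalgamE)
  interpret Ki: kleene_lattice "K i" using i(1) by (rule kleene_member)
  interpret Kj: kleene_lattice "K j" using j(1) by (rule kleene_member)
  have xy': "x \<sqsubseteq>\<^bsub>K i\<^esub> y" using xy i by (simp add: le_amalgam)
  have yz': "y \<sqsubseteq>\<^bsub>K j\<^esub> z" using yz j by (simp add: le_amalgam)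
  consider "i = j" | "y = \<zero>\<^bsub>M\<^esub>" | "y = \<one>\<^bsub>M\<^esub>"
    | (overlap) "i \<noteq> j" "y \<noteq> \<zero>\<^bsub>M\<^esub>" "y \<noteq> \<one>\<^bsub>M\<^esub>" by blast
  then show ?thesis
  proof cases
    assume "i = j"
    then show ?thesis using xy' yz' i j Ki.le_trans by (simp add: le_amalgam)
  next
    assume "y = \<zero>\<^bsub>M\<^esub>"
    then have "x = y" using xy' i by (simp add: zero_amalgam [OF i(1)] Ki.le_zero_iff)
    then show ?thesis using yz by simp
  next
    assume "y = \<one>\<^bsub>M\<^esub>"
    then have "z = y" using yz' j by (simp add: one_amalgam [OF j(1)] Kj.one_le_iff)
    then show ?thesis using xy by simp
  next
    case overlap
    then have "y \<in> C i \<inter> C j" using i j by blast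
    from overlap_cases [OF i(1) j(1) overlap(1) this overlap(2,3)] show ?thesis
    proof cases
      case 1
      then have "x = \<zero>\<^bsub>M\<^esub> \<or> x = y" using xy' i by (simp add: atom_def zero_amalgam [OF i(1)])
      moreover have "\<zero>\<^bsub>M\<^esub> \<sqsubseteq>\<^bsub>M\<^esub> z"
        using le_amalgam [OF j(1) zero_in_member [OF j(1)] j(3)] j
        by (simp add: zero_amalgam [OF j(1)])
      ultimately show ?thesis using yz by blast
    next
      case 2
      then have "z = \<one>\<^bsub>M\<^esub> \<or> z = y" using yz' j by (simp add: coatom_def one_amalgam [OF j(1)])
      moreover have "x \<sqsubseteq>\<^bsub>M\<^esub> \<one>\<^bsub>M\<^esub>"
        using le_amalgam [OF i(1) i(2) one_in_member [OF i(1)]] i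
        by (simp add: one_amalgam [OF i(1)])
      ultimately show ?thesis using xy by blast
    qed
  qed
qed

lemma bounded_involution_poset_amalgam: "bounded_involution_poset M"
proof -
  have eq: "(.=\<^bsub>M\<^esub>) = (=)" by (simp add: atomic_amalgam_def)
  have po: "partial_order M"
  proof (unfold_locales, unfold eq)
    fix x assume "x \<in> carrier M"
    then obtain i where i: "i \<in> I" "x \<in> C i" by (auto simp: carrier_amalgam)
    interpret Ki: kleene_lattice "K i" using i(1) by (rule kleene_member)
    show "x \<sqsubseteq>\<^bsub>M\<^esub> x" using i by (simp add: le_amalgam)
  next
    fix x y assume xy: "x \<sqsubseteq>\<^bsub>M\<^esub> y" "y \<sqsubseteq>\<^bsub>M\<^esub> x"
    obtain i where i: "i \<in> I" "x \<in> C i" "y \<in> C i" using xy(1) by (rule le_amalgamE)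
    interpret Ki: kleene_lattice "K i" using i(1) by (rule kleene_member)
    show "x = y" using xy i by (simp add: le_amalgam Ki.le_antisym)
  qed (use le_amalgam_trans in auto)
  show ?thesis
  proof (intro bounded_involution_poset.intro po bounded_involution_poset_axioms.intro)
    show "least M \<zero>\<^bsub>M\<^esub> (carrier M)"
      unfolding least_def
    proof (intro conjI ballI)
      show "\<zero>\<^bsub>M\<^esub> \<in> carrier M" using index_nonempty by (auto simp: carrier_amalgam)
      fix x assume "x \<in> carrier M"
      then obtain i where i: "i \<in> I" "x \<in> C i" by (auto simp: carrier_amalgam)
      interpret Ki: kleene_lattice "K i" using i(1) by (rule kleene_member)
      show "\<zero>\<^bsub>M\<^esub> \<sqsubseteq>\<^bsub>M\<^esub> x"
        using le_amalgam [OF i(1) zero_in_member [OF i(1)] i(2)] i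
        by (simp add: zero_amalgam [OF i(1)])
    qed simp
    show "greatest M \<one>\<^bsub>M\<^esub> (carrier M)"
      unfolding greatest_def
    proof (intro conjI ballI)
      show "\<one>\<^bsub>M\<^esub> \<in> carrier M" using index_nonempty by (auto simp: carrier_amalgam)
      fix x assume "x \<in> carrier M"
      then obtain i where i: "i \<in> I" "x \<in> C i" by (auto simp: carrier_amalgam)
      interpret Ki: kleene_lattice "K i" using i(1) by (rule kleene_member)
      show "x \<sqsubseteq>\<^bsub>M\<^esub> \<one>\<^bsub>M\<^esub>"
        using le_amalgam [OF i one_in_member [OF i(1)]] i by (simp add: one_amalgam [OF i(1)])
    qed simp
  next
    fix x assume "x \<in> carrier M"
    then obtain i where i: "i \<in> I" "x \<in> C i" by (auto simp: carrier_amalgam)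
    interpret Ki: kleene_lattice "K i" using i(1) by (rule kleene_member)
    show "\<sim>\<^bsub>M\<^esub> x \<in> carrier M" using i invol_in_member [OF i] by (auto simp: carrier_amalgam)
    show "\<sim>\<^bsub>M\<^esub> (\<sim>\<^bsub>M\<^esub> x) = x" using i by (simp add: invol_amalgam)
  next
    fix x y assume xy: "x \<sqsubseteq>\<^bsub>M\<^esub> y"
    obtain i where i: "i \<in> I" "x \<in> C i" "y \<in> C i" using xy by (rule le_amalgamE)
    interpret Ki: kleene_lattice "K i" using i(1) by (rule kleene_member)
    show "\<sim>\<^bsub>M\<^esub> y \<sqsubseteq>\<^bsub>M\<^esub> \<sim>\<^bsub>M\<^esub> x"
      using xy i by (simp add: invol_amalgam le_amalgam Ki.invol_antitone)
  qed
qed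

sublocale amalgam: bounded_involution_poset M
  by (rule bounded_involution_poset_amalgam)

lemma member_subset: "i \<in> I \<Longrightarrow> x \<in> C i \<Longrightarrow> x \<in> carrier M"
  by (auto simp: carrier_amalgam)

text \<open>The premise on the infimum descends to the member in which x and y are compared: a lower
  bound of x' and y found there is also one in the amalgam, hence 0.\<close>

lemma paraorthomodular_poset_amalgam: "paraorthomodular_poset M"
proof unfold_locales
  fix x y
  assume xy: "x \<sqsubseteq>\<^bsub>M\<^esub> y" and inf: "greatest M \<zero>\<^bsub>M\<^esub> (Lower M {\<sim>\<^bsub>M\<^esub> x, y})"
  obtain i where i: "i \<in> I" "x \<in> C i" "y \<in> C i" using xy by (rule le_amalgamE)
  interpret Ki: kleene_lattice "K i" using i(1) by (rule kleene_member)
  have x': "\<sim>\<^bsub>M\<^esub> x \<in> C i" using i invol_in_member by blast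
  have "greatest (K i) \<zero>\<^bsub>K i\<^esub> (Lower (K i) {\<sim>\<^bsub>K i\<^esub> x, y})"
    unfolding Ki.greatest_Lower_pair_iff [OF Ki.invol_closed [OF i(2)] i(3)]
  proof (intro conjI ballI impI)
    fix u assume u: "u \<in> C i" "u \<sqsubseteq>\<^bsub>K i\<^esub> \<sim>\<^bsub>K i\<^esub> x" "u \<sqsubseteq>\<^bsub>K i\<^esub> y"
    then have "u \<sqsubseteq>\<^bsub>M\<^esub> \<sim>\<^bsub>M\<^esub> x" "u \<sqsubseteq>\<^bsub>M\<^esub> y"
      using i x' by (simp_all add: le_amalgam [OF i(1)] invol_amalgam [OF i(1)])
    then have "u \<sqsubseteq>\<^bsub>M\<^esub> \<zero>\<^bsub>M\<^esub>"
      using inf member_subset [OF i(1)] u i x' by (simp add: amalgam.greatest_Lower_pair_iff)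
    then show "u \<sqsubseteq>\<^bsub>K i\<^esub> \<zero>\<^bsub>K i\<^esub>"
      using le_amalgam [OF i(1) u(1) zero_in_member [OF i(1)]] by (simp add: zero_amalgam [OF i(1)])
  qed (use i in auto)
  then show "x = y"
    using Ki.paraorthomodular xy i by (simp add: le_amalgam)
qed

section \<open>Atoms and coatoms of the amalgam\<close>

text \<open>For the converse, an element u below x may be compared with x in another member
  \<open>K j\<close>. There x is an atom as well: the alternative for overlaps would make x a coatom
  of \<open>K i\<close>, which no atom is.\<close>

lemma atom_amalgam_iff:
  assumes i: "i \<in> I" "x \<in> C i"
  shows "atom M x \<longleftrightarrow> atom (K i) x"
proof
  assume "atom M x"
  then show "atom (K i) x"
    using i le_amalgam member_subset unfolding atom_def by (metis zero_amalgam)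
next
  interpret Ki: kleene_lattice "K i" using i(1) by (rule kleene_member)
  assume a: "atom (K i) x"
  have nz: "x \<noteq> \<zero>\<^bsub>M\<^esub>" using a i by (simp add: atom_def zero_amalgam)
  have n1: "x \<noteq> \<one>\<^bsub>M\<^esub>"
    using Ki.atom_ne_one [OF member_big a] i by (simp add: one_amalgam)
  show "atom M x"
    unfolding atom_def
  proof (intro conjI ballI impI nz)
    show "x \<in> carrier M" using i member_subset by blast
    fix u assume u: "u \<sqsubseteq>\<^bsub>M\<^esub> x"
    then obtain j where j: "j \<in> I" "u \<in> C j" "x \<in> C j" by (rule le_amalgamE)
    have "atom (K j) x"
    proof (cases "i = j")
      case False
      then have "x \<in> C i \<inter> C j" using i j by blast
      from overlap_cases [OF i(1) j(1) False this nz n1] show ?thesis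
        by cases (use a i Ki.atom_not_coatom member_big in auto)
    qed (use a in simp)
    then show "u = \<zero>\<^bsub>M\<^esub> \<or> u = x"
      using u j by (simp add: atom_def le_amalgam zero_amalgam)
  qed
qed

text \<open>Follows from the case of atoms, since the involution exchanges atoms and coatoms in the
  amalgam and in each member.\<close>

lemma coatom_amalgam_iff:
  assumes i: "i \<in> I" "x \<in> C i"
  shows "coatom M x \<longleftrightarrow> coatom (K i) x"
proof -
  interpret Ki: kleene_lattice "K i" using i(1) by (rule kleene_member)
  have "coatom M x \<longleftrightarrow> atom M (\<sim>\<^bsub>M\<^esub> x)"
    using i member_subset amalgam.atom_invol_iff by blast
  also have "\<dots> \<longleftrightarrow> atom (K i) (\<sim>\<^bsub>M\<^esub> x)" using i atom_amalgam_iff invol_in_member by blast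
  also have "\<dots> \<longleftrightarrow> coatom (K i) x" using i by (simp add: invol_amalgam Ki.atom_invol_iff)
  finally show ?thesis .
qed

lemma amalgam_atom_not_coatom: "atom M x \<Longrightarrow> \<not> coatom M x"
proof -
  assume a: "atom M x"
  then obtain i where i: "i \<in> I" "x \<in> C i" by (auto simp: atom_def carrier_amalgam)
  interpret Ki: kleene_lattice "K i" using i(1) by (rule kleene_member)
  show "\<not> coatom M x"
    using a i Ki.atom_not_coatom [OF member_big] by (simp add: atom_amalgam_iff coatom_amalgam_iff)
qed

lemma amalgam_atom_ne_one: "atom M x \<Longrightarrow> x \<noteq> \<one>\<^bsub>M\<^esub>"
proof -
  assume a: "atom M x"
  then obtain i where i: "i \<in> I" "x \<in> C i" by (auto simp: atom_def carrier_amalgam)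
  interpret Ki: kleene_lattice "K i" using i(1) by (rule kleene_member)
  show "x \<noteq> \<one>\<^bsub>M\<^esub>"
    using a i Ki.atom_ne_one [OF member_big] by (simp add: atom_amalgam_iff one_amalgam)
qed

section \<open>Overlaps of members\<close>

lemma overlap_atom_or_coatom:
  assumes "i \<in> I" "j \<in> I" "i \<noteq> j" "x \<in> C i" "x \<in> C j" "x \<noteq> \<zero>\<^bsub>M\<^esub>" "x \<noteq> \<one>\<^bsub>M\<^esub>"
  shows "atom M x \<or> coatom M x"
  using assms overlap_cases [of i j x] atom_amalgam_iff coatom_amalgam_iff by blast

text \<open>One of x and x' is an atom and the other a coatom, so they differ and 0, 1, x, x' are
  four elements of the overlap. It has at most four, so these are all.\<close>

lemma overlap:
  assumes ij: "i \<in> I" "j \<in> I" "i \<noteq> j" and x: "x \<in> C i" "x \<in> C j" "x \<noteq> \<zero>\<^bsub>M\<^esub>" "x \<noteq> \<one>\<^bsub>M\<^esub>"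
  shows overlap_eq: "C i \<inter> C j = {\<zero>\<^bsub>M\<^esub>, \<one>\<^bsub>M\<^esub>, x, \<sim>\<^bsub>M\<^esub> x}" (is "_ = ?S")
    and overlap_card: "card (C i \<inter> C j) = 4"
proof -
  have xM: "x \<in> carrier M" using ij x member_subset by blast
  have ne: "\<sim>\<^bsub>M\<^esub> x \<noteq> x"
    using overlap_atom_or_coatom [OF ij x] amalgam_atom_not_coatom
      amalgam.atom_invol_iff [OF xM] amalgam.coatom_invol_iff [OF xM] by metis
  have "\<sim>\<^bsub>M\<^esub> x \<noteq> \<zero>\<^bsub>M\<^esub>" "\<sim>\<^bsub>M\<^esub> x \<noteq> \<one>\<^bsub>M\<^esub>"
    using x xM amalgam.invol_invol amalgam.invol_zero amalgam.invol_one by metis+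
  with x ne zero_ne_one have card: "card ?S = 4" by simp
  have sub: "?S \<subseteq> C i \<inter> C j" using ij x invol_in_member by auto
  have fin: "finite (C i \<inter> C j)" using ij finite_member by blast
  have "card (C i \<inter> C j) \<le> card ?S" using card_intersection ij card by simp
  then show *: "C i \<inter> C j = ?S" using card_seteq [OF fin sub] by simp
  show "card (C i \<inter> C j) = 4" using card * by simp
qed

lemma overlap_trivial:
  assumes ij: "i \<in> I" "j \<in> I" and "\<And>x. x \<in> C i \<Longrightarrow> x \<in> C j \<Longrightarrow> x = \<zero>\<^bsub>M\<^esub> \<or> x = \<one>\<^bsub>M\<^esub>"
  shows "C i \<inter> C j = {\<zero>\<^bsub>M\<^esub>, \<one>\<^bsub>M\<^esub>}"
  using assms by auto

text \<open>Four elements leave one besides the bounds; it is an atom, or a coatom whose involute is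
  the required atom.\<close>

lemma overlap_atom:
  assumes ij: "i \<in> I" "j \<in> I" and card: "card (C i \<inter> C j) = 4"
  obtains a where "i \<noteq> j" "a \<in> C i" "a \<in> C j" "atom M a"
proof -
  have ne: "i \<noteq> j" using card member_big [OF ij(1)] by auto
  have "\<exists>x. x \<in> C i \<and> x \<in> C j \<and> x \<noteq> \<zero>\<^bsub>M\<^esub> \<and> x \<noteq> \<one>\<^bsub>M\<^esub>"
  proof (rule ccontr)
    assume "\<not> ?thesis"
    then have "C i \<inter> C j = {\<zero>\<^bsub>M\<^esub>, \<one>\<^bsub>M\<^esub>}" using ij overlap_trivial by blast
    then show False using card zero_ne_one by simp
  qed
  then obtain x where x: "x \<in> C i" "x \<in> C j" "x \<noteq> \<zero>\<^bsub>M\<^esub>" "x \<noteq> \<one>\<^bsub>M\<^esub>" by blast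
  have "x \<in> carrier M" using ij x member_subset by blast
  then have "atom M x \<or> atom M (\<sim>\<^bsub>M\<^esub> x)"
    using overlap_atom_or_coatom [OF ij ne x] by (simp add: amalgam.atom_invol_iff)
  then show thesis using that ne ij x invol_in_member by blast
qed

text \<open>The overlap of different members would be {0, 1, a, a'}, forcing b = a', a
  coatom.\<close>

lemma distinct_atoms_one_member:
  assumes ij: "i \<in> I" "j \<in> I" and a: "atom M a" "a \<in> C i" "a \<in> C j"
    and b: "atom M b" "b \<in> C i" "b \<in> C j" and ne: "a \<noteq> b"
  shows "i = j"
proof (rule ccontr)
  assume "i \<noteq> j"
  then have "C i \<inter> C j = {\<zero>\<^bsub>M\<^esub>, \<one>\<^bsub>M\<^esub>, a, \<sim>\<^bsub>M\<^esub> a}"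
    using overlap_eq ij a amalgam_atom_ne_one unfolding atom_def by blast
  then have "b = \<sim>\<^bsub>M\<^esub> a" using b ne amalgam_atom_ne_one unfolding atom_def by blast
  then have "coatom M b" using a amalgam.atom_imp_coatom_invol by blast
  then show False using b amalgam_atom_not_coatom by blast
qed

lemma distinct_coatoms_one_member:
  assumes ij: "i \<in> I" "j \<in> I" and a: "coatom M a" "a \<in> C i" "a \<in> C j"
    and b: "coatom M b" "b \<in> C i" "b \<in> C j" and ne: "a \<noteq> b"
  shows "i = j"
proof (rule distinct_atoms_one_member [OF ij])
  show "atom M (\<sim>\<^bsub>M\<^esub> a)" "atom M (\<sim>\<^bsub>M\<^esub> b)"
    using a b amalgam.coatom_imp_atom_invol by blast+
  show "\<sim>\<^bsub>M\<^esub> a \<noteq> \<sim>\<^bsub>M\<^esub> b"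
    using ne a b amalgam.invol_invol unfolding coatom_def by metis
qed (use ij a b invol_in_member in blast)+

text \<open>Lying strictly between a nonzero element and an element other than 1, s is neither atom
  nor coatom, whereas overlaps contain only atoms, coatoms and bounds.\<close>

lemma interior_one_member:
  assumes "i \<in> I" "j \<in> I" "s \<in> C i" "s \<in> C j"
    and a: "a \<noteq> \<zero>\<^bsub>M\<^esub>" "a \<sqsubseteq>\<^bsub>M\<^esub> s" "a \<noteq> s" and c: "c \<noteq> \<one>\<^bsub>M\<^esub>" "s \<sqsubseteq>\<^bsub>M\<^esub> c" "s \<noteq> c"
  shows "i = j"
proof (rule ccontr)
  assume "i \<noteq> j"
  have M: "a \<in> carrier M" "s \<in> carrier M" "c \<in> carrier M"
    using a(2) c(2) by (meson le_amalgamE member_subset)+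
  have "s \<noteq> \<zero>\<^bsub>M\<^esub>" using a M amalgam.le_zero_iff by blast
  moreover have "s \<noteq> \<one>\<^bsub>M\<^esub>" using c M amalgam.one_le_iff by blast
  ultimately have "atom M s \<or> coatom M s"
    using overlap_atom_or_coatom \<open>i \<noteq> j\<close> assms(1-4) by blast
  then show False using a c M unfolding atom_def coatom_def by blast
qed

lemma atoms_le_invol:
  assumes i: "i \<in> I" "a \<in> C i" "b \<in> C i" and ab: "atom M a" "atom M b" "a \<noteq> b"
  shows "a \<sqsubseteq>\<^bsub>M\<^esub> \<sim>\<^bsub>M\<^esub> b"
proof -
  interpret Ki: kleene_lattice "K i" using i(1) by (rule kleene_member)
  show ?thesis
    using i ab Ki.distinct_atoms_le_invol by (simp add: invol_amalgam le_amalgam atom_amalgam_iff)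
qed

section \<open>Atomic loops and suprema\<close>

text \<open>Replaces the index sequence by three members. For n = 3 all pairs of distinct indices
  are neighbours in the cycle, so the condition on other pairs is vacuous, and there is just one
  triple.\<close>

lemma loop3_iff:
  "(\<exists>s. atomic_loop I K 3 s) \<longleftrightarrow>
    (\<exists>i\<in>I. \<exists>j\<in>I. \<exists>k\<in>I. card (C i \<inter> C j) = 4 \<and> card (C j \<inter> C k) = 4 \<and> card (C k \<inter> C i) = 4 \<and>
      C i \<inter> C j \<inter> C k = {\<zero>\<^bsub>M\<^esub>, \<one>\<^bsub>M\<^esub>})" (is "?L \<longleftrightarrow> ?R")
proof
  assume ?L
  then obtain s where s: "atomic_loop I K 3 s" ..
  have "s 1 \<in> I" "s 2 \<in> I" "s 3 \<in> I" "card (C (s 3) \<inter> C (s 1)) = 4"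
    using s unfolding atomic_loop_def by auto
  moreover have "\<forall>n. 1 \<le> n \<and> n < 3 \<longrightarrow> card (C (s n) \<inter> C (s (n + 1))) = 4"
    using s unfolding atomic_loop_def by (elim conjE)
  from this [rule_format, of 1] this [rule_format, of 2] have "card (C (s 1) \<inter> C (s 2)) = 4" "card (C (s 2) \<inter> C (s 3)) = 4"
    by (simp_all add: numeral_eq_Suc)
  moreover have "\<forall>j k l. 1 \<le> j \<and> j < k \<and> k < l \<and> l \<le> 3 \<longrightarrow>
      C (s j) \<inter> C (s k) \<inter> C (s l) = {\<zero>\<^bsub>M\<^esub>, \<one>\<^bsub>M\<^esub>}"
    using s unfolding atomic_loop_def by (elim conjE)
  then have "C (s 1) \<inter> C (s 2) \<inter> C (s 3) = {\<zero>\<^bsub>M\<^esub>, \<one>\<^bsub>M\<^esub>}" by simp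
  ultimately show ?R by blast
next
  assume ?R
  then obtain i j k where ijk: "i \<in> I" "j \<in> I" "k \<in> I"
    "card (C i \<inter> C j) = 4" "card (C j \<inter> C k) = 4" "card (C k \<inter> C i) = 4"
    "C i \<inter> C j \<inter> C k = {\<zero>\<^bsub>M\<^esub>, \<one>\<^bsub>M\<^esub>}" by blast
  define s where "s n = (if n = 1 then i else if n = 2 then j else k)" for n :: nat
  have 1: "n = 1 \<or> n = 2" if "1 \<le> n" "n < 3" for n :: nat using that by linarith
  have 2: "a = 1 \<and> b = 2 \<and> c = 3" if "1 \<le> a" "a < b" "b < c" "c \<le> 3" for a b c :: nat
    using that by linarith
  have "atomic_loop I K 3 s"
    unfolding atomic_loop_def
  proof (intro conjI allI impI ballI)
    fix n :: nat assume "1 \<le> n \<and> n < 3"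
    then show "card (C (s n) \<inter> C (s (n + 1))) = 4" using 1 [of n] ijk by (auto simp: s_def)
  next
    fix a b c :: nat assume "1 \<le> a \<and> a < b \<and> b < c \<and> c \<le> 3"
    then have "a = 1 \<and> b = 2 \<and> c = 3" using 2 by blast
    then show "C (s a) \<inter> C (s b) \<inter> C (s c) = {\<zero>\<^bsub>M\<^esub>, \<one>\<^bsub>M\<^esub>}" using ijk by (simp add: s_def)
  next
    fix a b :: nat
    assume "a \<in> {1..3}" "b \<in> {1..3}" "a \<noteq> b \<and> b \<noteq> a + 1 \<and> a \<noteq> b + 1 \<and> {a, b} \<noteq> {1, 3}"
    moreover from this have "a = 1 \<or> a = 2 \<or> a = 3" "b = 1 \<or> b = 2 \<or> b = 3" by auto
    ultimately show "C (s a) \<inter> C (s b) = {\<zero>\<^bsub>M\<^esub>, \<one>\<^bsub>M\<^esub>}" by auto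
  qed (use ijk in \<open>auto simp: s_def\<close>)
  then show ?L by blast
qed

text \<open>Replaces the index sequence by four members. Only the two opposite pairs remain for the
  condition on other pairs. Any three of the four indices include an opposite pair, so the condition
  on triples follows.\<close>

lemma loop4_iff:
  "(\<exists>s. atomic_loop I K 4 s) \<longleftrightarrow>
    (\<exists>i\<in>I. \<exists>j\<in>I. \<exists>k\<in>I. \<exists>l\<in>I. card (C i \<inter> C j) = 4 \<and> card (C j \<inter> C k) = 4 \<and>
      card (C k \<inter> C l) = 4 \<and> card (C l \<inter> C i) = 4 \<and>
      C i \<inter> C k = {\<zero>\<^bsub>M\<^esub>, \<one>\<^bsub>M\<^esub>} \<and> C j \<inter> C l = {\<zero>\<^bsub>M\<^esub>, \<one>\<^bsub>M\<^esub>})" (is "?L \<longleftrightarrow> ?R")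
proof
  assume ?L
  then obtain s where s: "atomic_loop I K 4 s" ..
  have "s 1 \<in> I" "s 2 \<in> I" "s 3 \<in> I" "s 4 \<in> I" "card (C (s 4) \<inter> C (s 1)) = 4"
    using s unfolding atomic_loop_def by auto
  moreover have "\<forall>n. 1 \<le> n \<and> n < 4 \<longrightarrow> card (C (s n) \<inter> C (s (n + 1))) = 4"
    using s unfolding atomic_loop_def by (elim conjE)
  from this [rule_format, of 1] this [rule_format, of 2] this [rule_format, of 3]
  have "card (C (s 1) \<inter> C (s 2)) = 4" "card (C (s 2) \<inter> C (s 3)) = 4" "card (C (s 3) \<inter> C (s 4)) = 4"
    by (simp_all add: numeral_eq_Suc)
  moreover have opp: "\<forall>a\<in>{1..4}. \<forall>b\<in>{1..4}.
      a \<noteq> b \<and> b \<noteq> a + 1 \<and> a \<noteq> b + 1 \<and> {a, b} \<noteq> {1, 4} \<longrightarrow>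
      C (s a) \<inter> C (s b) = {\<zero>\<^bsub>M\<^esub>, \<one>\<^bsub>M\<^esub>}"
    using s unfolding atomic_loop_def by (elim conjE)
  have "{1, 3::nat} \<noteq> {1, 4}" "{2, 4::nat} \<noteq> {1, 4}" by (simp_all add: doubleton_eq_iff)
  then have "C (s 1) \<inter> C (s 3) = {\<zero>\<^bsub>M\<^esub>, \<one>\<^bsub>M\<^esub>}" "C (s 2) \<inter> C (s 4) = {\<zero>\<^bsub>M\<^esub>, \<one>\<^bsub>M\<^esub>}"
    using opp [rule_format, of 1 3] opp [rule_format, of 2 4] by simp_all
  ultimately show ?R by blast
next
  assume ?R
  then obtain i j k l where ijkl: "i \<in> I" "j \<in> I" "k \<in> I" "l \<in> I"
    "card (C i \<inter> C j) = 4" "card (C j \<inter> C k) = 4" "card (C k \<inter> C l) = 4" "card (C l \<inter> C i) = 4"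
    and opp: "C i \<inter> C k = {\<zero>\<^bsub>M\<^esub>, \<one>\<^bsub>M\<^esub>}" "C j \<inter> C l = {\<zero>\<^bsub>M\<^esub>, \<one>\<^bsub>M\<^esub>}" by blast
  define s where "s n = (if n = 1 then i else if n = 2 then j else if n = 3 then k else l)" for n :: nat
  have s_simps: "s 1 = i" "s 2 = j" "s 3 = k" "s 4 = l" by (simp_all add: s_def)
  have 1: "n = 1 \<or> n = 2 \<or> n = 3" if "1 \<le> n" "n < 4" for n :: nat using that by linarith
  have opp': "C k \<inter> C i = {\<zero>\<^bsub>M\<^esub>, \<one>\<^bsub>M\<^esub>}" "C l \<inter> C j = {\<zero>\<^bsub>M\<^esub>, \<one>\<^bsub>M\<^esub>}" using opp by blast+
  have triple: "C i \<inter> C j \<inter> C k \<subseteq> {\<zero>\<^bsub>M\<^esub>, \<one>\<^bsub>M\<^esub>}" "C i \<inter> C j \<inter> C l \<subseteq> {\<zero>\<^bsub>M\<^esub>, \<one>\<^bsub>M\<^esub>}"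
    "C i \<inter> C k \<inter> C l \<subseteq> {\<zero>\<^bsub>M\<^esub>, \<one>\<^bsub>M\<^esub>}" "C j \<inter> C k \<inter> C l \<subseteq> {\<zero>\<^bsub>M\<^esub>, \<one>\<^bsub>M\<^esub>}"
    using opp by blast+
  have 2: "(a, b, c) \<in> {(1, 2, 3), (1, 2, 4), (1, 3, 4), (2, 3, 4)}"
    if "1 \<le> a" "a < b" "b < c" "c \<le> 4" for a b c :: nat
    using that by simp linarith
  have "atomic_loop I K 4 s"
    unfolding atomic_loop_def
  proof (intro conjI allI impI ballI)
    fix n :: nat assume "1 \<le> n \<and> n < 4"
    then show "card (C (s n) \<inter> C (s (n + 1))) = 4" using 1 [of n] ijkl by (auto simp: s_def)
  next
    fix a b c :: nat assume "1 \<le> a \<and> a < b \<and> b < c \<and> c \<le> 4"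
    then have "(a, b, c) \<in> {(1, 2, 3), (1, 2, 4), (1, 3, 4), (2, 3, 4)}" using 2 by blast
    then have "C (s a) \<inter> C (s b) \<inter> C (s c) \<subseteq> {\<zero>\<^bsub>M\<^esub>, \<one>\<^bsub>M\<^esub>}"
      by (elim insertE emptyE) (simp_all only: prod.inject s_simps triple)
    moreover have "s n \<in> I" for n using ijkl by (simp add: s_def)
    then have "{\<zero>\<^bsub>M\<^esub>, \<one>\<^bsub>M\<^esub>} \<subseteq> C (s a) \<inter> C (s b) \<inter> C (s c)" by simp
    ultimately show "C (s a) \<inter> C (s b) \<inter> C (s c) = {\<zero>\<^bsub>M\<^esub>, \<one>\<^bsub>M\<^esub>}"
      by (rule subset_antisym)
  next
    fix a b :: nat
    assume ab: "a \<in> {1..4}" "b \<in> {1..4}" "a \<noteq> b \<and> b \<noteq> a + 1 \<and> a \<noteq> b + 1 \<and> {a, b} \<noteq> {1, 4}"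
    have "n = 1 \<or> n = 2 \<or> n = 3 \<or> n = 4" if "n \<in> {1..4}" for n :: nat
      using that by auto
    from this [OF ab(1)] this [OF ab(2)]
    have "(a, b) \<in> {(1, 3), (3, 1), (2, 4), (4, 2)}"
      using ab(3) by (elim disjE) (simp_all add: doubleton_eq_iff)
    then show "C (s a) \<inter> C (s b) = {\<zero>\<^bsub>M\<^esub>, \<one>\<^bsub>M\<^esub>}"
      by (elim insertE emptyE) (simp_all only: prod.inject s_simps opp opp')
  qed (use ijkl in \<open>auto simp: s_def\<close>)
  then show ?L by blast
qed

section \<open>Suprema exclude loops of order 3 and 4\<close>

lemma atom_ne_zero: "atom M x \<Longrightarrow> x \<noteq> \<zero>\<^bsub>M\<^esub>"
  by (simp add: atom_def)

text \<open>Expresses the join of one member in the order of the amalgam. It is least only among the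
  upper bounds in that member; bounds elsewhere need a separate argument.\<close>

lemma member_join:
  assumes i: "i \<in> I" and x: "x \<in> C i" and y: "y \<in> C i"
  obtains d where "d \<in> C i" "x \<sqsubseteq>\<^bsub>M\<^esub> d" "y \<sqsubseteq>\<^bsub>M\<^esub> d"
    "\<And>u. u \<in> C i \<Longrightarrow> x \<sqsubseteq>\<^bsub>M\<^esub> u \<Longrightarrow> y \<sqsubseteq>\<^bsub>M\<^esub> u \<Longrightarrow> d \<sqsubseteq>\<^bsub>M\<^esub> u"
    "atom M x \<Longrightarrow> atom M y \<Longrightarrow> d \<noteq> \<one>\<^bsub>M\<^esub>"
proof -
  interpret Ki: kleene_lattice "K i" using i by (rule kleene_member)
  let ?d = "x \<squnion>\<^bsub>K i\<^esub> y"
  have d: "?d \<in> C i" using x y by simp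
  show thesis
  proof (rule that [OF d])
    show "x \<sqsubseteq>\<^bsub>M\<^esub> ?d" using le_amalgam [OF i x d] Ki.join_left [OF x y] by blast
    show "y \<sqsubseteq>\<^bsub>M\<^esub> ?d" using le_amalgam [OF i y d] Ki.join_right [OF x y] by blast
    show "?d \<sqsubseteq>\<^bsub>M\<^esub> u" if "u \<in> C i" "x \<sqsubseteq>\<^bsub>M\<^esub> u" "y \<sqsubseteq>\<^bsub>M\<^esub> u" for u
      using that Ki.join_le [of x u y] x y d by (simp add: le_amalgam [OF i])
    show "?d \<noteq> \<one>\<^bsub>M\<^esub>" if "atom M x" "atom M y"
      using that Ki.join_atoms_ne_one [OF member_big [OF i]] x y
      by (simp add: atom_amalgam_iff [OF i] one_amalgam [OF i])
  qed
qed

lemma atom_above_atom: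
  assumes "atom M a" "atom M b" "b \<sqsubseteq>\<^bsub>M\<^esub> a"
  shows "a = b"
  using assms unfolding atom_def by blast

lemma lattice_imp_no_loop3:
  assumes "lattice M"
  shows "\<not> (\<exists>s. atomic_loop I K 3 s)"
proof
  interpret M: lattice M by fact
  assume "\<exists>s. atomic_loop I K 3 s"
  then obtain i j k where I: "i \<in> I" "j \<in> I" "k \<in> I"
    and card: "card (C i \<inter> C j) = 4" "card (C j \<inter> C k) = 4" "card (C k \<inter> C i) = 4"
    and triple: "C i \<inter> C j \<inter> C k = {\<zero>\<^bsub>M\<^esub>, \<one>\<^bsub>M\<^esub>}"
    unfolding loop3_iff by blast
  obtain a where a: "i \<noteq> j" "a \<in> C i" "a \<in> C j" "atom M a" by (rule overlap_atom [OF I(1,2) card(1)])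
  obtain b where b: "j \<noteq> k" "b \<in> C j" "b \<in> C k" "atom M b" by (rule overlap_atom [OF I(2,3) card(2)])
  obtain c where c: "k \<noteq> i" "c \<in> C k" "c \<in> C i" "atom M c" by (rule overlap_atom [OF I(3,1) card(3)])
  have bounds: "x \<noteq> \<zero>\<^bsub>M\<^esub>" "x \<noteq> \<one>\<^bsub>M\<^esub>" if "x \<in> {a, b, c}" for x
    using that a b c atom_ne_zero amalgam_atom_ne_one by blast+
  \<comment> \<open>Each of these coincidences would put an atom into all three members.\<close>
  have ne: "a \<noteq> b" "b \<noteq> c" "a \<noteq> c" "c \<notin> C j" using a b c triple bounds by blast+
  let ?c' = "\<sim>\<^bsub>M\<^esub> c"
  have M: "a \<in> carrier M" "b \<in> carrier M" "c \<in> carrier M" using a b c by (auto simp: atom_def)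
  have ac: "a \<sqsubseteq>\<^bsub>M\<^esub> ?c'" using atoms_le_invol [OF I(1)] a c ne by blast
  have bc: "b \<sqsubseteq>\<^bsub>M\<^esub> ?c'" using atoms_le_invol [OF I(3)] b c ne by blast
  have c': "coatom M ?c'" using c amalgam.atom_imp_coatom_invol by blast
  obtain d where d: "d \<in> C j" "a \<sqsubseteq>\<^bsub>M\<^esub> d" "b \<sqsubseteq>\<^bsub>M\<^esub> d" "d \<noteq> \<one>\<^bsub>M\<^esub>"
    using member_join [OF I(2) a(3) b(2)] a(4) b(4) by metis
  have dM: "d \<in> carrier M" using member_subset I(2) d(1) by blast
  obtain s where "least M s (Upper M {a, b})" using M.sup_of_two_exists [OF M(1,2)] ..
  then have s: "s \<in> carrier M" "a \<sqsubseteq>\<^bsub>M\<^esub> s" "b \<sqsubseteq>\<^bsub>M\<^esub> s"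
    and least: "\<And>u. u \<in> carrier M \<Longrightarrow> a \<sqsubseteq>\<^bsub>M\<^esub> u \<Longrightarrow> b \<sqsubseteq>\<^bsub>M\<^esub> u \<Longrightarrow> s \<sqsubseteq>\<^bsub>M\<^esub> u"
    by (simp_all add: amalgam.least_Upper_pair_iff [OF M(1,2)])
  have sd: "s \<sqsubseteq>\<^bsub>M\<^esub> d" using least d dM by blast
  have sc: "s \<sqsubseteq>\<^bsub>M\<^esub> ?c'" using least ac bc M by simp
  have "a \<noteq> s" "b \<noteq> s" using s atom_above_atom a b ne by blast+
  \<comment> \<open>Otherwise the coatom c' is below \<open>d\<close>, which is not 1, so
    \<open>d\<close> = c'; then c lies in \<open>C j\<close> and hence in all three members.\<close>
  have "s \<noteq> ?c'"
  proof
    assume "s = ?c'"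
    then have "d = ?c'" using sd c' d dM unfolding coatom_def by blast
    then have "\<sim>\<^bsub>M\<^esub> ?c' \<in> C j" using d I invol_in_member by blast
    then show False using ne M by simp
  qed
  obtain p where p: "p \<in> I" "a \<in> C p" "s \<in> C p" using s(2) by (rule le_amalgamE)
  obtain q where q: "q \<in> I" "b \<in> C q" "s \<in> C q" using s(3) by (rule le_amalgamE)
  obtain r where r: "r \<in> I" "s \<in> C r" "?c' \<in> C r" using sc by (rule le_amalgamE)
  have "c \<in> C r" using r invol_in_member [OF r(1,3)] M by simp
  have uniq: "t = u" if "t \<in> I" "u \<in> I" "s \<in> C t" "s \<in> C u" for t u
    by (rule interior_one_member [OF that atom_ne_zero [OF a(4)] s(2) \<open>a \<noteq> s\<close> _ sc \<open>s \<noteq> ?c'\<close>])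
      (use c' in \<open>simp add: coatom_def\<close>)
  have "p = q" "p = r" using uniq p q r by blast+
  \<comment> \<open>The single member containing s contains a, b and c. The atoms a, b identify it
    as j and the atoms a, c as i.\<close>
  then have "p = j" "p = i"
    using distinct_atoms_one_member a b c I p q r \<open>c \<in> C r\<close> ne by blast+
  then show False using a by simp
qed

lemma lattice_imp_no_loop4:
  assumes "lattice M"
  shows "\<not> (\<exists>s. atomic_loop I K 4 s)"
proof
  interpret M: lattice M by fact
  assume "\<exists>s. atomic_loop I K 4 s"
  then obtain i j k l where I: "i \<in> I" "j \<in> I" "k \<in> I" "l \<in> I"
    and card: "card (C i \<inter> C j) = 4" "card (C j \<inter> C k) = 4" "card (C k \<inter> C l) = 4" "card (C l \<inter> C i) = 4"
    and opp: "C i \<inter> C k = {\<zero>\<^bsub>M\<^esub>, \<one>\<^bsub>M\<^esub>}" "C j \<inter> C l = {\<zero>\<^bsub>M\<^esub>, \<one>\<^bsub>M\<^esub>}"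
    unfolding loop4_iff by blast
  obtain a where a: "i \<noteq> j" "a \<in> C i" "a \<in> C j" "atom M a" by (rule overlap_atom [OF I(1,2) card(1)])
  obtain b where b: "j \<noteq> k" "b \<in> C j" "b \<in> C k" "atom M b" by (rule overlap_atom [OF I(2,3) card(2)])
  obtain c where c: "k \<noteq> l" "c \<in> C k" "c \<in> C l" "atom M c" by (rule overlap_atom [OF I(3,4) card(3)])
  obtain d where d: "l \<noteq> i" "d \<in> C l" "d \<in> C i" "atom M d" by (rule overlap_atom [OF I(4,1) card(4)])
  have bounds: "x \<noteq> \<zero>\<^bsub>M\<^esub>" "x \<noteq> \<one>\<^bsub>M\<^esub>" if "x \<in> {a, b, c, d}" for x
    using that a b c d atom_ne_zero amalgam_atom_ne_one by blast+
  \<comment> \<open>Any two of the four atoms, if equal, would give a common atom of two opposite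
    members.\<close>
  have ne: "a \<noteq> b" "b \<noteq> c" "c \<noteq> d" "a \<noteq> d" "a \<noteq> c" "b \<noteq> d"
    using a b c d opp bounds by blast+
  let ?b' = "\<sim>\<^bsub>M\<^esub> b" and ?d' = "\<sim>\<^bsub>M\<^esub> d"
  have M: "a \<in> carrier M" "b \<in> carrier M" "c \<in> carrier M" "d \<in> carrier M"
    using a b c d by (auto simp: atom_def)
  have b': "coatom M ?b'" using b amalgam.atom_imp_coatom_invol by blast
  have d': "coatom M ?d'" using d amalgam.atom_imp_coatom_invol by blast
  have ab: "a \<sqsubseteq>\<^bsub>M\<^esub> ?b'" using atoms_le_invol [OF I(2)] a b ne by blast
  have cb: "c \<sqsubseteq>\<^bsub>M\<^esub> ?b'" using atoms_le_invol [OF I(3)] c b ne by blast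
  have ad: "a \<sqsubseteq>\<^bsub>M\<^esub> ?d'" using atoms_le_invol [OF I(1)] a d ne by blast
  have cd: "c \<sqsubseteq>\<^bsub>M\<^esub> ?d'" using atoms_le_invol [OF I(4)] c d ne by blast
  obtain s where "least M s (Upper M {a, c})" using M.sup_of_two_exists [OF M(1,3)] ..
  then have s: "s \<in> carrier M" "a \<sqsubseteq>\<^bsub>M\<^esub> s" "c \<sqsubseteq>\<^bsub>M\<^esub> s"
    and least: "\<And>u. u \<in> carrier M \<Longrightarrow> a \<sqsubseteq>\<^bsub>M\<^esub> u \<Longrightarrow> c \<sqsubseteq>\<^bsub>M\<^esub> u \<Longrightarrow> s \<sqsubseteq>\<^bsub>M\<^esub> u"
    by (simp_all add: amalgam.least_Upper_pair_iff [OF M(1,3)])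
  have sb: "s \<sqsubseteq>\<^bsub>M\<^esub> ?b'" using least ab cb M by simp
  have sd: "s \<sqsubseteq>\<^bsub>M\<^esub> ?d'" using least ad cd M by simp
  have "a \<noteq> s" using s atom_above_atom a c ne by blast
  \<comment> \<open>Otherwise b' \<sqsubseteq> d', and since both are coatoms, b = d.\<close>
  have "s \<noteq> ?b'"
  proof
    assume "s = ?b'"
    then have "?d' = ?b'" using sd b' d' unfolding coatom_def by blast
    then have "\<sim>\<^bsub>M\<^esub> ?d' = \<sim>\<^bsub>M\<^esub> ?b'" by simp
    then show False using ne M by simp
  qed
  obtain p where p: "p \<in> I" "a \<in> C p" "s \<in> C p" using s(2) by (rule le_amalgamE)
  obtain q where q: "q \<in> I" "c \<in> C q" "s \<in> C q" using s(3) by (rule le_amalgamE)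
  obtain r where r: "r \<in> I" "s \<in> C r" "?b' \<in> C r" using sb by (rule le_amalgamE)
  have "b \<in> C r" using r invol_in_member [OF r(1,3)] M by simp
  have uniq: "t = u" if "t \<in> I" "u \<in> I" "s \<in> C t" "s \<in> C u" for t u
    by (rule interior_one_member [OF that atom_ne_zero [OF a(4)] s(2) \<open>a \<noteq> s\<close> _ sb \<open>s \<noteq> ?b'\<close>])
      (use b' in \<open>simp add: coatom_def\<close>)
  have "p = q" "p = r" using uniq p q r by blast+
  \<comment> \<open>The single member containing s contains a, b and c. The atoms a, b identify it
    as j and the atoms b, c as k.\<close>
  then have "p = j" "p = k"
    using distinct_atoms_one_member a b c I p q r \<open>b \<in> C r\<close> ne by blast+
  then show False using b by simp
qed

section \<open>Absence of loops of order 3 and 4 gives suprema\<close>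

text \<open>Three members meeting pairwise but not forming a loop of order 3 share one and the same
  four-element subalgebra.\<close>

lemma triangle_collapse:
  assumes no3: "\<not> (\<exists>s. atomic_loop I K 3 s)"
    and I: "i \<in> I" "j \<in> I" "k \<in> I" and ne: "i \<noteq> j" "j \<noteq> k" "k \<noteq> i"
    and x: "x \<in> C i" "x \<in> C j" "x \<noteq> \<zero>\<^bsub>M\<^esub>" "x \<noteq> \<one>\<^bsub>M\<^esub>"
    and y: "y \<in> C j" "y \<in> C k" "y \<noteq> \<zero>\<^bsub>M\<^esub>" "y \<noteq> \<one>\<^bsub>M\<^esub>"
    and z: "z \<in> C k" "z \<in> C i" "z \<noteq> \<zero>\<^bsub>M\<^esub>" "z \<noteq> \<one>\<^bsub>M\<^esub>"
  shows "x \<in> C k"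
proof -
  have "card (C i \<inter> C j) = 4" "card (C j \<inter> C k) = 4" "card (C k \<inter> C i) = 4"
    using overlap_card I ne x y z by blast+
  then have "C i \<inter> C j \<inter> C k \<noteq> {\<zero>\<^bsub>M\<^esub>, \<one>\<^bsub>M\<^esub>}" using no3 I unfolding loop3_iff by blast
  moreover have "{\<zero>\<^bsub>M\<^esub>, \<one>\<^bsub>M\<^esub>} \<subseteq> C i \<inter> C j \<inter> C k" using I by simp
  ultimately obtain w where w: "w \<in> C i" "w \<in> C j" "w \<in> C k" "w \<noteq> \<zero>\<^bsub>M\<^esub>" "w \<noteq> \<one>\<^bsub>M\<^esub>" by blast
  then have "C i \<inter> C j = {\<zero>\<^bsub>M\<^esub>, \<one>\<^bsub>M\<^esub>, w, \<sim>\<^bsub>M\<^esub> w}" using overlap_eq I ne by blast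
  then have "x = w \<or> x = \<sim>\<^bsub>M\<^esub> w" using x by blast
  then show ?thesis using w I invol_in_member by blast
qed

text \<open>The join in \<open>K i\<close> is the supremum, because every upper bound of x and y
  lies in \<open>C i\<close>: one outside would be linked to x and to y in two further members and
  close a triangle.\<close>

lemma sup_in_member:
  assumes no3: "\<not> (\<exists>s. atomic_loop I K 3 s)"
    and i: "i \<in> I" and x: "x \<in> C i" and y: "y \<in> C i"
    and xy: "\<not> x \<sqsubseteq>\<^bsub>M\<^esub> y" "\<not> y \<sqsubseteq>\<^bsub>M\<^esub> x"
  shows "\<exists>s. least M s (Upper M {x, y})"
proof -
  have M: "x \<in> carrier M" "y \<in> carrier M" using i x y member_subset by blast+
  have bounds: "x \<noteq> \<zero>\<^bsub>M\<^esub>" "x \<noteq> \<one>\<^bsub>M\<^esub>" "y \<noteq> \<zero>\<^bsub>M\<^esub>" "y \<noteq> \<one>\<^bsub>M\<^esub>" "x \<noteq> y" using xy M by auto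
  obtain d where d: "d \<in> C i" "x \<sqsubseteq>\<^bsub>M\<^esub> d" "y \<sqsubseteq>\<^bsub>M\<^esub> d"
    and least: "\<And>u. u \<in> C i \<Longrightarrow> x \<sqsubseteq>\<^bsub>M\<^esub> u \<Longrightarrow> y \<sqsubseteq>\<^bsub>M\<^esub> u \<Longrightarrow> d \<sqsubseteq>\<^bsub>M\<^esub> u"
    by (rule member_join [OF i x y]) blast
  have dM: "d \<in> carrier M" using i d member_subset by blast
  have "d \<sqsubseteq>\<^bsub>M\<^esub> u" if u: "u \<in> carrier M" "x \<sqsubseteq>\<^bsub>M\<^esub> u" "y \<sqsubseteq>\<^bsub>M\<^esub> u" for u
  proof (cases "u \<in> C i")
    case True
    then show ?thesis using least u by blast
  next
    case False
    then have u1: "u \<noteq> \<one>\<^bsub>M\<^esub>" "u \<noteq> \<zero>\<^bsub>M\<^esub>" "u \<noteq> x" "u \<noteq> y" using i x y by auto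
    obtain j where j: "j \<in> I" "x \<in> C j" "u \<in> C j" using u(2) by (rule le_amalgamE)
    obtain k where k: "k \<in> I" "y \<in> C k" "u \<in> C k" using u(3) by (rule le_amalgamE)
    have ne: "j \<noteq> i" "k \<noteq> i" using j k False by auto
    \<comment> \<open>Both elements lie strictly below u, which is not 1. As elements of overlaps
      they must then be atoms.\<close>
    have "\<not> coatom M x" "\<not> coatom M y" using u u1 unfolding coatom_def by blast+
    then have at: "atom M x" "atom M y"
      using overlap_atom_or_coatom i j k ne x y bounds by blast+
    have "j \<noteq> k" using distinct_atoms_one_member i j k ne x y at bounds by blast
    \<comment> \<open>In the triangle j, k, i the shared elements are u, y and x. It collapses, so u
      reaches the third member.\<close>
    then have "u \<in> C i"
      using triangle_collapse [OF no3 j(1) k(1) i, of u y x] j k ne x y bounds u1 by blast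
    then show ?thesis using False by blast
  qed
  then show ?thesis using d dM by (auto simp: amalgam.least_Upper_pair_iff [OF M])
qed

text \<open>The comparisons of x and y with u use different members, so u lies in an overlap. It is
  not an atom: then x would be 0 or u, and x would share a member with y.\<close>

lemma upper_bound_across_members:
  assumes apart: "\<And>i. i \<in> I \<Longrightarrow> x \<in> C i \<Longrightarrow> y \<in> C i \<Longrightarrow> False"
    and u: "u \<in> carrier M" "x \<sqsubseteq>\<^bsub>M\<^esub> u" "y \<sqsubseteq>\<^bsub>M\<^esub> u" "u \<noteq> \<one>\<^bsub>M\<^esub>"
  obtains j k where "j \<in> I" "x \<in> C j" "u \<in> C j" "k \<in> I" "y \<in> C k" "u \<in> C k" "j \<noteq> k"
    "coatom M u" "u \<noteq> \<zero>\<^bsub>M\<^esub>"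
proof -
  obtain j where j: "j \<in> I" "x \<in> C j" "u \<in> C j" using u(2) by (rule le_amalgamE)
  obtain k where k: "k \<in> I" "y \<in> C k" "u \<in> C k" using u(3) by (rule le_amalgamE)
  have M: "x \<in> carrier M" using j member_subset by blast
  have ne: "j \<noteq> k" "x \<noteq> u" "x \<noteq> \<zero>\<^bsub>M\<^esub>" using apart j k by auto
  have "u \<noteq> \<zero>\<^bsub>M\<^esub>" using ne u M amalgam.le_zero_iff by blast
  moreover have "\<not> atom M u" using ne u M unfolding atom_def by blast
  ultimately have "coatom M u" using overlap_atom_or_coatom j k ne u by blast
  then show thesis using that j k ne \<open>u \<noteq> \<zero>\<^bsub>M\<^esub>\<close> by blast
qed

text \<open>Distinct u and v give the cycle j, k, m, l whose neighbours share u, y, v and x in turn.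
  Degenerate cycles and nontrivial diagonals put x and y into one member or violate uniqueness of
  the member containing two coatoms. What remains is a loop of order 4.\<close>

lemma upper_bound_across_members_unique:
  assumes no3: "\<not> (\<exists>s. atomic_loop I K 3 s)" and no4: "\<not> (\<exists>s. atomic_loop I K 4 s)"
    and apart: "\<And>i. i \<in> I \<Longrightarrow> x \<in> C i \<Longrightarrow> y \<in> C i \<Longrightarrow> False"
    and u: "u \<in> carrier M" "x \<sqsubseteq>\<^bsub>M\<^esub> u" "y \<sqsubseteq>\<^bsub>M\<^esub> u" "u \<noteq> \<one>\<^bsub>M\<^esub>"
    and v: "v \<in> carrier M" "x \<sqsubseteq>\<^bsub>M\<^esub> v" "y \<sqsubseteq>\<^bsub>M\<^esub> v" "v \<noteq> \<one>\<^bsub>M\<^esub>"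
  shows "u = v"
proof (rule ccontr)
  assume uv: "u \<noteq> v"
  obtain j k where jk: "j \<in> I" "x \<in> C j" "u \<in> C j" "k \<in> I" "y \<in> C k" "u \<in> C k" "j \<noteq> k"
    "coatom M u" "u \<noteq> \<zero>\<^bsub>M\<^esub>"
    by (rule upper_bound_across_members [OF apart u])
  obtain l m where lm: "l \<in> I" "x \<in> C l" "v \<in> C l" "m \<in> I" "y \<in> C m" "v \<in> C m" "l \<noteq> m"
    "coatom M v" "v \<noteq> \<zero>\<^bsub>M\<^esub>"
    by (rule upper_bound_across_members [OF apart v])
  have ne: "j \<noteq> m" "k \<noteq> l" using jk lm apart by blast+
  have x: "x \<noteq> \<zero>\<^bsub>M\<^esub>" "x \<noteq> \<one>\<^bsub>M\<^esub>" and y: "y \<noteq> \<zero>\<^bsub>M\<^esub>" "y \<noteq> \<one>\<^bsub>M\<^esub>"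
    using apart jk by auto
  \<comment> \<open>Here w is a nontrivial common element of the diagonal pair j, m; the triangle k,
    m, j then collapses. The next fact is its counterpart for the diagonal k, l.\<close>
  have kmj: "y \<in> C j" if "k \<noteq> m" "w \<in> C m" "w \<in> C j" "w \<noteq> \<zero>\<^bsub>M\<^esub>" "w \<noteq> \<one>\<^bsub>M\<^esub>" for w
    using triangle_collapse [OF no3 jk(4) lm(4) jk(1), of y w u] that jk lm ne y u(4) by blast
  have jlk: "x \<in> C k" if "j \<noteq> l" "w \<in> C l" "w \<in> C k" "w \<noteq> \<zero>\<^bsub>M\<^esub>" "w \<noteq> \<one>\<^bsub>M\<^esub>" for w
    using triangle_collapse [OF no3 jk(1) lm(1) jk(4), of x w u] that jk lm ne x u(4) by blast
  have "j \<noteq> l"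
  proof
    assume "j = l"
    show False
    proof (cases "k = m")
      case True
      then show False
        using distinct_coatoms_one_member [of j k u v] jk lm uv \<open>j = l\<close> by blast
    next
      case False
      then show False using kmj [of v] lm v(4) \<open>j = l\<close> jk apart by blast
    qed
  qed
  \<comment> \<open>If k = m, then v is common to l and k, and the triangle j, l, k collapses,
    putting x into \<open>C k\<close> beside y.\<close>
  have "k \<noteq> m"
    using jlk [of v] lm v(4) jk apart \<open>j \<noteq> l\<close> by blast
  have "y \<notin> C j" "x \<notin> C k" using apart jk by blast+
  have "C j \<inter> C m = {\<zero>\<^bsub>M\<^esub>, \<one>\<^bsub>M\<^esub>}"
    by (rule overlap_trivial [OF jk(1) lm(4)]) (use kmj \<open>k \<noteq> m\<close> \<open>y \<notin> C j\<close> in blast)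
  moreover have "C k \<inter> C l = {\<zero>\<^bsub>M\<^esub>, \<one>\<^bsub>M\<^esub>}"
    by (rule overlap_trivial [OF jk(4) lm(1)]) (use jlk \<open>j \<noteq> l\<close> \<open>x \<notin> C k\<close> in blast)
  moreover have "card (C j \<inter> C k) = 4" "card (C k \<inter> C m) = 4" "card (C m \<inter> C l) = 4" "card (C l \<inter> C j) = 4"
    using overlap_card [OF jk(1,4,7,3,6,9) u(4)] overlap_card [OF jk(4) lm(4) \<open>k \<noteq> m\<close> jk(5) lm(5) y]
      overlap_card [OF lm(4,1) lm(7) [symmetric] lm(6,3,9) v(4)]
      overlap_card [OF lm(1) jk(1) \<open>j \<noteq> l\<close> [symmetric] lm(2) jk(2) x] .
  ultimately show False using no4 jk(1,4) lm(1,4) unfolding loop4_iff by blast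
qed

lemma no_loops_imp_lattice:
  assumes no3: "\<not> (\<exists>s. atomic_loop I K 3 s)" and no4: "\<not> (\<exists>s. atomic_loop I K 4 s)"
  shows "lattice M"
proof (rule amalgam.lattice_if_sups)
  fix x y
  assume M: "x \<in> carrier M" "y \<in> carrier M"
  note sup_iff = amalgam.least_Upper_pair_iff [OF M]
  consider "x \<sqsubseteq>\<^bsub>M\<^esub> y" | "y \<sqsubseteq>\<^bsub>M\<^esub> x"
    | (together) i where "i \<in> I" "x \<in> C i" "y \<in> C i" "\<not> x \<sqsubseteq>\<^bsub>M\<^esub> y" "\<not> y \<sqsubseteq>\<^bsub>M\<^esub> x"
    | (apart) "\<And>i. i \<in> I \<Longrightarrow> x \<in> C i \<Longrightarrow> y \<in> C i \<Longrightarrow> False" by blast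
  then show "\<exists>s. least M s (Upper M {x, y})"
  proof cases
    case 1
    then have "least M y (Upper M {x, y})" using M by (simp add: sup_iff)
    then show ?thesis ..
  next
    case 2
    then have "least M x (Upper M {x, y})" using M by (simp add: sup_iff)
    then show ?thesis ..
  next
    case together
    then show ?thesis using sup_in_member no3 by blast
  next
    \<comment> \<open>At most one upper bound differs from 1, so that one, or 1 if there is none, is
      the supremum.\<close>
    case apart
    show ?thesis
    proof (cases "\<exists>u. u \<in> carrier M \<and> x \<sqsubseteq>\<^bsub>M\<^esub> u \<and> y \<sqsubseteq>\<^bsub>M\<^esub> u \<and> u \<noteq> \<one>\<^bsub>M\<^esub>")
      case True
      then obtain u where u: "u \<in> carrier M" "x \<sqsubseteq>\<^bsub>M\<^esub> u" "y \<sqsubseteq>\<^bsub>M\<^esub> u" "u \<noteq> \<one>\<^bsub>M\<^esub>" by blast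
      have "u \<sqsubseteq>\<^bsub>M\<^esub> v" if v: "v \<in> carrier M" "x \<sqsubseteq>\<^bsub>M\<^esub> v" "y \<sqsubseteq>\<^bsub>M\<^esub> v" for v
      proof (cases "v = \<one>\<^bsub>M\<^esub>")
        case False
        have "u = v"
          by (rule upper_bound_across_members_unique [OF no3 no4 apart u v False])
        then show ?thesis using u by simp
      qed (use u in simp)
      then have "least M u (Upper M {x, y})" using u by (simp add: sup_iff)
      then show ?thesis ..
    next
      case False
      then have "least M \<one>\<^bsub>M\<^esub> (Upper M {x, y})" using M by (auto simp: sup_iff)
      then show ?thesis ..
    qed
  qed
qed

end

theorem theorem4p11:
  fixes I :: "'i set" and K :: "'i \<Rightarrow> 'a inv_poset"
  assumes "pasted_family I K"
  shows "paraorthomodular_lattice (atomic_amalgam I K) \<longleftrightarrow>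
    \<not> (\<exists>n s. n \<in> {3, 4} \<and> atomic_loop I K n s)"
proof -
  interpret pasted_family I K by fact
  have "paraorthomodular_lattice M \<longleftrightarrow> lattice M"
    using paraorthomodular_poset_amalgam by (simp add: paraorthomodular_lattice_def)
  also have "\<dots> \<longleftrightarrow> \<not> (\<exists>s. atomic_loop I K 3 s) \<and> \<not> (\<exists>s. atomic_loop I K 4 s)"
    using lattice_imp_no_loop3 lattice_imp_no_loop4 no_loops_imp_lattice by blast
  finally show ?thesis by blast
qed

end
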